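(* Let $n\ge1$ and let $f:DO(n)\to\mathbb{R}_{>0}$ be continuous. Suppose that the relation $\sqsubseteq^f$ on $DO(n)$ is a partial order such that (1) the completely mixed state $\bot_n=\frac1nI_n$ is the least element; (2) each state is below the pure state corresponding to its highest eigenvector, i.e. $\rho\sqsubseteq^f|v\rangle\langle v|$ for every state $\rho$ and every unit vector $v$ in the eigenspace of the highest eigenvalue of $\rho$; (3) $\sqsubseteq^f$ respects the convex structure of $DO(n)$: $\rho\sqsubseteq^f\sigma$ if and only if $\rho\sqsubseteq^f(1-t)\rho+t\sigma\sqsubseteq^f\sigma$ for all $0\le t\le1$. Then $\sqsubseteq^f$ equals the QPE order $\sqsubseteq$.
   Context: $DO(n)=\{A\in M_n(\mathbb{C}) : A\ge 0,\ \operatorname{tr}A=1\}$ is the set of states, where $A\ge0$ means positive semidefinite and $A\ge B$ means $A-B\ge 0$. $\rho^+$ denotes the highest eigenvalue of $\rho$ (its operator norm). The QPE order on $DO(n)$ is the partial order $$\rho\sqsubseteq\sigma \iff \frac{\rho}{\rho^+}\ge\frac{\sigma}{\sigma^+}\iff \sigma^+\rho-\rho^+\sigma\ge 0 .$$ For $f:DO(n)\to\mathbb{R}_{>0}$ continuous, the $f$-renormalised order is the relation $$\rho\sqsubseteq^f\pi\iff\frac{\rho}{f(\rho)}\ge\frac{\pi}{f(\pi)}\iff f(\pi)\rho-f(\rho)\pi\ge0 .$$ *)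

theory Defs
  imports "HOL-Analysis.Analysis"
begin

definition hermitian :: "complex^'n^'n \<Rightarrow> bool" where
  "hermitian A \<longleftrightarrow> (\<forall>i j. A $ i $ j = cnj (A $ j $ i))"

definition psd :: "complex^'n::finite^'n \<Rightarrow> bool" where
  "psd A \<longleftrightarrow> hermitian A \<and> (\<forall>x. 0 \<le> Re (\<Sum>i\<in>UNIV. cnj (x $ i) * (A *v x) $ i))"

(* The library order on vectors is componentwise, so the Loewner order needs its own name. *)
definition loewner_ge :: "complex^'n::finite^'n \<Rightarrow> complex^'n^'n \<Rightarrow> bool" where
  "loewner_ge A B \<longleftrightarrow> psd (A - B)"

definition DO :: "(complex^'n::finite^'n) set" where
  "DO = {A. psd A \<and> trace A = 1}"

definition eigenvector :: "complex^'n::finite^'n \<Rightarrow> complex^'n \<Rightarrow> real \<Rightarrow> bool" where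
  "eigenvector A v l \<longleftrightarrow> v \<noteq> 0 \<and> A *v v = complex_of_real l *s v"

(* Only used for Hermitian matrices, whose spectrum is real, nonempty and finite. *)
definition highest_eigenvalue :: "complex^'n::finite^'n \<Rightarrow> real" where
  "highest_eigenvalue A = (GREATEST l. \<exists>v. eigenvector A v l)"

definition completely_mixed :: "complex^'n::finite^'n" where
  "completely_mixed = (1 / real CARD('n)) *\<^sub>R mat 1"

(* The rank-one matrix |v><v|. *)
definition pure_state :: "complex^'n::finite \<Rightarrow> complex^'n^'n" where
  "pure_state v = (\<chi> i j. v $ i * cnj (v $ j))"

definition qpe_order :: "(complex^'n::finite^'n) rel" where
  "qpe_order = {(\<rho>, \<sigma>). \<rho> \<in> DO \<and> \<sigma> \<in> DO \<and>
     loewner_ge (\<rho> /\<^sub>R highest_eigenvalue \<rho>) (\<sigma> /\<^sub>R highest_eigenvalue \<sigma>)}"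

definition renormalised_order :: "(complex^'n::finite^'n \<Rightarrow> real) \<Rightarrow> (complex^'n^'n) rel" where
  "renormalised_order f = {(\<rho>, \<pi>). \<rho> \<in> DO \<and> \<pi> \<in> DO \<and>
     loewner_ge (\<rho> /\<^sub>R f \<rho>) (\<pi> /\<^sub>R f \<pi>)}"

end

theory Submission
  imports Defs
begin

text \<open>
  Write \<open>\<bottom>\<close> for the completely mixed state, \<open>c = n f(\<bottom>)\<close> and \<open>\<rho>\<^sup>+\<close> for the highest eigenvalue.
  Evaluating \<open>\<bottom> \<sqsubseteq> \<rho>\<close> and \<open>\<rho> \<sqsubseteq> |v><v|\<close> at a highest unit eigenvector \<open>v\<close> gives
  \<open>c \<rho>\<^sup>+ \<le> f(\<rho>) \<le> f(|v><v|) \<rho>\<^sup>+\<close>, so it suffices that \<open>f\<close> equals \<open>c\<close> on pure states.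

  Extend the segment from \<open>P = |v><v|\<close> to \<open>\<bottom>\<close> beyond \<open>\<bottom>\<close>, through the states
  \<open>\<tau>\<^sub>s = (I - s P) / (n - s)\<close>. By continuity, some \<open>s\<close> makes the \<open>v\<close>-eigenvalues of
  \<open>\<tau>\<^sub>s / f(\<tau>\<^sub>s)\<close> and \<open>P / f(P)\<close> agree, and then \<open>\<tau>\<^sub>s \<sqsubseteq> P\<close>. As \<open>\<bottom>\<close> lies between the
  two, convexity yields \<open>\<tau>\<^sub>s \<sqsubseteq> \<bottom>\<close>, hence \<open>\<tau>\<^sub>s = \<bottom>\<close>, and comparing the \<open>v\<close>-eigenvalues
  gives \<open>f(P) = c\<close>.
\<close>

section \<open>Positive semidefinite matrices as real quadratic forms\<close>

lemma inner_complex_vec: "x \<bullet> y = (\<Sum>i\<in>UNIV. Re (cnj (x $ i) * y $ i))"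
  for x y :: "complex^'n::finite"
  by (simp add: inner_vec_def inner_complex_def)

text \<open>The inner product \<open>\<bullet>\<close> on complex vectors is the real part of the
  Hermitian one, so positivity becomes a question about a real quadratic form on a Euclidean
  space.\<close>

lemma psd_iff_inner: "psd A \<longleftrightarrow> hermitian A \<and> (\<forall>x. 0 \<le> x \<bullet> (A *v x))"
  by (simp add: psd_def inner_complex_vec)

lemma psd_inner_nonneg: "psd A \<Longrightarrow> 0 \<le> x \<bullet> (A *v x)"
  by (simp add: psd_iff_inner)

lemma scaleR_mult_vec: "(c *\<^sub>R A) *v x = c *\<^sub>R (A *v x)"
  for A :: "complex^'n::finite^'m::finite"
  by (simp add: matrix_vector_mult_def vec_eq_iff scaleR_sum_right)

lemma mult_vec_scaleR: "A *v (c *\<^sub>R x) = c *\<^sub>R (A *v x)"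
  for A :: "complex^'n::finite^'m::finite"
  by (simp add: matrix_vector_mult_def vec_eq_iff scaleR_sum_right)

lemma of_real_vector_mult: "complex_of_real c *s v = c *\<^sub>R v"
  by (simp add: vec_eq_iff) (simp add: scaleR_conv_of_real)

lemma hermitian_inner:
  assumes "hermitian A"
  shows "x \<bullet> (A *v y) = (A *v x) \<bullet> y"
proof -
  have "x \<bullet> (A *v y) = (\<Sum>i\<in>UNIV. \<Sum>j\<in>UNIV. Re (cnj (x $ i) * (A $ i $ j * y $ j)))"
    by (simp only: inner_complex_vec matrix_vector_mult_def vec_lambda_beta sum_distrib_left Re_sum)
  also have "\<dots> = (\<Sum>j\<in>UNIV. \<Sum>i\<in>UNIV. Re (cnj (x $ i) * (A $ i $ j * y $ j)))"
    by (rule sum.swap)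
  also have "\<dots> = (\<Sum>j\<in>UNIV. \<Sum>i\<in>UNIV. Re (cnj (A $ j $ i * x $ i) * y $ j))"
  proof (intro sum.cong refl)
    fix i j
    have A: "A $ i $ j = cnj (A $ j $ i)"
      using assms unfolding hermitian_def by blast
    show "Re (cnj (x $ i) * (A $ i $ j * y $ j)) = Re (cnj (A $ j $ i * x $ i) * y $ j)"
      by (subst A) (simp only: complex_cnj_mult mult_ac)
  qed
  also have "\<dots> = (A *v x) \<bullet> y"
    by (simp only: inner_complex_vec matrix_vector_mult_def vec_lambda_beta cnj_sum
        sum_distrib_right Re_sum)
  finally show ?thesis .
qed

lemma hermitian_mat_1: "hermitian (mat 1)"
  by (auto simp: hermitian_def mat_def)

lemma hermitian_pure_state: "hermitian (pure_state v)"
  by (simp add: hermitian_def pure_state_def)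

lemma hermitian_scaleR: "hermitian A \<Longrightarrow> hermitian (c *\<^sub>R A)"
  unfolding hermitian_def by (metis complex_cnj_scaleR vector_scaleR_component)

lemma hermitian_diff: "hermitian A \<Longrightarrow> hermitian B \<Longrightarrow> hermitian (A - B)"
  unfolding hermitian_def by (metis complex_cnj_diff vector_minus_component)

lemma psd_scaleR: "psd A \<Longrightarrow> 0 \<le> c \<Longrightarrow> psd (c *\<^sub>R A)"
  by (simp add: psd_iff_inner hermitian_scaleR scaleR_mult_vec)

lemma psd_scaleR_iff:
  assumes "0 < c"
  shows "psd (c *\<^sub>R A) \<longleftrightarrow> psd A"
  using psd_scaleR[of A c] psd_scaleR[of "c *\<^sub>R A" "inverse c"] assms by auto

text \<open>The form is nonnegative and vanishes at \<open>v\<close>, so \<open>v\<close> minimises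
  it. Its derivative there in the direction \<open>w = A *v v\<close> is
  \<open>2 * (w \<bullet> w)\<close>, which must therefore be zero.\<close>

lemma psd_null_vector:
  assumes "psd A" and "v \<bullet> (A *v v) = 0"
  shows "A *v v = 0"
proof -
  define w where "w = A *v v"
  define K where "K = w \<bullet> (A *v w)"
  have K: "0 \<le> K"
    unfolding K_def using assms(1) by (rule psd_inner_nonneg)
  have q: "0 \<le> 2 * s * (w \<bullet> w) + s^2 * K" for s
  proof -
    have "v \<bullet> (A *v w) = w \<bullet> w"
      using hermitian_inner[of A v w] assms(1) by (simp add: w_def psd_def)
    then have "(v + s *\<^sub>R w) \<bullet> (A *v (v + s *\<^sub>R w)) = 2 * s * (w \<bullet> w) + s^2 * K"
      using assms(2)
      by (simp add: matrix_vector_right_distrib mult_vec_scaleR inner_add_left inner_add_right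
          distrib_left K_def power2_eq_square flip: w_def)
    then show ?thesis
      using psd_inner_nonneg[OF assms(1), of "v + s *\<^sub>R w"] by simp
  qed
  \<comment> \<open>A step short enough, against \<open>w\<close>, that the linear term of \<open>q\<close> dominates\<close>
  have "0 \<le> - (w \<bullet> w) / (K + 1) * (2 * (w \<bullet> w) - (w \<bullet> w) / (K + 1) * K)"
    using q[of "- (w \<bullet> w) / (K + 1)"] by (simp add: power2_eq_square algebra_simps)
  moreover have "2 * (w \<bullet> w) - (w \<bullet> w) / (K + 1) * K = (w \<bullet> w) * (K + 2) / (K + 1)"
    using K by (simp add: field_simps)
  ultimately have "0 \<le> - ((w \<bullet> w) / (K + 1))\<^sup>2 * (K + 2)"
    by (simp add: power2_eq_square)
  then have "((w \<bullet> w) / (K + 1))\<^sup>2 * (K + 2) \<le> 0"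
    by simp
  then have "((w \<bullet> w) / (K + 1))\<^sup>2 \<le> 0"
    using K by (auto simp: mult_le_0_iff)
  then have "w = 0"
    using K by auto
  then show ?thesis
    by (simp add: w_def)
qed

lemma norm_axis_one: "norm (axis i 1 :: complex^'n::finite) = 1"
  by (simp add: norm_eq_1 inner_axis_axis)

text \<open>A maximiser of the Rayleigh quotient is a null vector of the psd matrix \<open>l I - A\<close>.\<close>
lemma highest_eigenvalue_attained:
  fixes A :: "complex^'n::finite^'n"
  assumes A: "hermitian A"
  obtains v where "norm v = 1" "eigenvector A v (highest_eigenvalue A)"
proof -
  let ?q = "\<lambda>x. x \<bullet> (A *v x)"
  have "linear ((*v) A)"
    by (intro linearI) (simp_all add: matrix_vector_right_distrib mult_vec_scaleR)
  then have cont: "continuous_on (sphere 0 1) ?q"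
    by (intro continuous_intros linear_continuous_on linear_conv_bounded_linear[THEN iffD1])
  have "axis undefined 1 \<in> sphere (0 :: complex^'n) 1"
    by (simp add: norm_axis_one)
  then obtain v where v: "norm v = 1" and max: "\<And>x. norm x = 1 \<Longrightarrow> ?q x \<le> ?q v"
    using continuous_attains_sup[OF compact_sphere _ cont] by force
  define l where "l = ?q v"
  \<comment> \<open>The maximum over the unit sphere bounds the form everywhere, because both sides
    are homogeneous of degree two.\<close>
  have bound: "?q x \<le> l * (x \<bullet> x)" for x
  proof (cases "x = 0")
    case False
    define y where "y = x /\<^sub>R norm x"
    have x: "x = norm x *\<^sub>R y" and "norm y = 1"
      using False by (simp_all add: y_def)
    then have "y \<bullet> y = 1"
      by (simp add: norm_eq_1)
    have "?q x = (norm x)\<^sup>2 * ?q y"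
      by (subst (1 2) x) (simp add: mult_vec_scaleR power2_eq_square)
    also have "\<dots> \<le> (norm x)\<^sup>2 * l"
      using max[OF \<open>norm y = 1\<close>] by (simp add: l_def mult_left_mono)
    finally show ?thesis
      by (simp add: power2_norm_eq_inner mult.commute)
  qed simp
  have psd: "psd (l *\<^sub>R mat 1 - A)"
    using bound A
    by (simp add: psd_iff_inner hermitian_diff hermitian_scaleR hermitian_mat_1
        matrix_vector_mult_diff_rdistrib scaleR_mult_vec inner_diff_right)
  have "(l *\<^sub>R mat 1 - A) *v v = 0"
    using psd v by (intro psd_null_vector)
      (simp_all add: matrix_vector_mult_diff_rdistrib scaleR_mult_vec inner_diff_right
        l_def norm_eq_1)
  then have eig: "eigenvector A v l"
    using v by (auto simp: eigenvector_def of_real_vector_mult matrix_vector_mult_diff_rdistrib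
        scaleR_mult_vec)
  have "highest_eigenvalue A = l"
    unfolding highest_eigenvalue_def
  proof (rule Greatest_equality)
    show "\<exists>v. eigenvector A v l"
      using eig by blast
    fix m
    assume "\<exists>w. eigenvector A w m"
    then obtain w where w: "w \<noteq> 0" "A *v w = m *\<^sub>R w"
      by (auto simp: eigenvector_def of_real_vector_mult)
    \<comment> \<open>Any eigenvalue is the Rayleigh quotient of its eigenvector, hence at most the
      maximum \<open>l\<close>.\<close>
    then have "m * (w \<bullet> w) \<le> l * (w \<bullet> w)"
      using bound[of w] by simp
    then show "m \<le> l"
      using w by simp
  qed
  then show thesis
    using that v eig by blast
qed

section \<open>Pure states as rank-one projections\<close>

lemma pure_state_mult_vec: "pure_state v *v x = (\<Sum>j\<in>UNIV. cnj (v $ j) * x $ j) *s v"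
  by (simp add: vec_eq_iff pure_state_def matrix_vector_mult_def sum_distrib_right)
    (simp add: mult_ac)

lemma sum_cnj_mult_self: "(\<Sum>j\<in>UNIV. cnj (v $ j) * v $ j) = complex_of_real ((norm v)\<^sup>2)"
proof -
  have "(\<Sum>j\<in>UNIV. cnj (v $ j) * v $ j) = (\<Sum>j\<in>UNIV. complex_of_real (v $ j \<bullet> v $ j))"
    by (intro sum.cong refl) (simp add: complex_eq_iff inner_complex_def)
  then show ?thesis
    by (simp add: power2_norm_eq_inner inner_vec_def)
qed

lemma pure_state_mult_self:
  assumes "norm v = 1"
  shows "pure_state v *v v = v"
  using assms by (simp add: pure_state_mult_vec sum_cnj_mult_self)

lemma trace_pure_state: "trace (pure_state v) = complex_of_real ((norm v)\<^sup>2)"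
  unfolding sum_cnj_mult_self[symmetric] by (simp add: trace_def pure_state_def mult.commute)

lemma inner_pure_state:
  "x \<bullet> (pure_state v *v x) = (norm (\<Sum>j\<in>UNIV. cnj (v $ j) * x $ j))\<^sup>2"
proof -
  define c where "c = (\<Sum>j\<in>UNIV. cnj (v $ j) * x $ j)"
  have "x \<bullet> (pure_state v *v x) = (\<Sum>i\<in>UNIV. Re (c * (cnj (x $ i) * v $ i)))"
    by (simp only: pure_state_mult_vec inner_complex_vec vector_smult_component mult.left_commute
        flip: c_def)
  also have "\<dots> = Re (c * (\<Sum>i\<in>UNIV. cnj (x $ i) * v $ i))"
    by (simp only: sum_distrib_left Re_sum)
  also have "(\<Sum>i\<in>UNIV. cnj (x $ i) * v $ i) = cnj c"
    by (simp add: c_def mult.commute)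
  also have "Re (c * cnj c) = (norm c)\<^sup>2"
    by (simp add: complex_norm_square[symmetric] del: of_real_power)
  finally show ?thesis
    by (simp add: c_def)
qed

lemma psd_pure_state: "psd (pure_state v)"
  by (simp add: psd_iff_inner hermitian_pure_state inner_pure_state)

lemma pure_state_in_DO: "norm v = 1 \<Longrightarrow> pure_state v \<in> DO"
  by (simp add: DO_def psd_pure_state trace_pure_state)

lemma inner_pure_state_le:
  assumes "norm v = 1"
  shows "x \<bullet> (pure_state v *v x) \<le> x \<bullet> x"
proof -
  define c where "c = (\<Sum>j\<in>UNIV. cnj (v $ j) * x $ j)"
  \<comment> \<open>For unit \<open>v\<close>, \<open>c *s v\<close> is the orthogonal projection of
    \<open>x\<close> onto the line of \<open>v\<close>. Cauchy-Schwarz for \<open>x\<close> and this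
    projection, whose inner product is the square of \<open>norm c\<close>, bounds
    \<open>norm c\<close> by \<open>norm x\<close>.\<close>
  have "norm (c *s v) = norm c"
    using assms by (simp add: norm_vec_def L2_set_def norm_mult power_mult_distrib
        real_sqrt_mult flip: sum_distrib_left)
  then have "(norm c)\<^sup>2 \<le> norm x * norm c"
    using norm_cauchy_schwarz[of x "c *s v"] inner_pure_state[of x v]
    by (simp add: pure_state_mult_vec flip: c_def)
  then have "norm c \<le> norm x"
    by (cases "c = 0") (simp_all add: power2_eq_square)
  then have "(norm c)\<^sup>2 \<le> (norm x)\<^sup>2"
    by (simp add: power_mono)
  then show ?thesis
    by (simp add: inner_pure_state power2_norm_eq_inner flip: c_def)
qed

section \<open>The states on the line through a pure state and the completely mixed state\<close>

lemma psd_mat_1_minus_pure_state: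
  assumes "norm v = 1" and "s \<le> 1"
  shows "psd (mat 1 - s *\<^sub>R pure_state v)"
proof -
  have "s * (x \<bullet> (pure_state v *v x)) \<le> x \<bullet> x" for x
    using mult_right_mono[OF assms(2), of "x \<bullet> (pure_state v *v x)"]
      inner_pure_state_le[OF assms(1), of x] by (simp add: inner_pure_state)
  then show ?thesis
    by (simp add: psd_iff_inner hermitian_diff hermitian_scaleR hermitian_mat_1
        hermitian_pure_state matrix_vector_mult_diff_rdistrib scaleR_mult_vec inner_diff_right)
qed

text \<open>At \<open>n = 1\<close>, \<open>s = 1\<close> the factor is the junk value \<open>1 / 0 = 0\<close>; hence the bound \<open>s < n\<close> below.\<close>
definition depleted :: "complex^'n::finite \<Rightarrow> real \<Rightarrow> complex^'n^'n" where
  "depleted v s = (1 / (real CARD('n) - s)) *\<^sub>R (mat 1 - s *\<^sub>R pure_state v)"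

lemma depleted_0: "depleted v 0 = completely_mixed"
  by (simp add: depleted_def completely_mixed_def)

lemma trace_scaleR: "trace (c *\<^sub>R A) = c *\<^sub>R trace A"
  for A :: "complex^'n::finite^'n"
  by (simp add: trace_def scaleR_sum_right)

lemma depleted_in_DO:
  fixes v :: "complex^'n::finite"
  assumes "norm v = 1" "s \<le> 1" "s < real CARD('n)"
  shows "depleted v s \<in> DO"
proof -
  have "trace (mat 1 - s *\<^sub>R pure_state v) = complex_of_real (real CARD('n) - s)"
    using assms(1) by (simp add: trace_sub trace_I trace_scaleR trace_pure_state)
      (simp add: scaleR_conv_of_real)
  then have "trace (depleted v s) = 1"
    using assms(3) unfolding depleted_def trace_scaleR
    by (simp add: complex_eq_iff)
  then show ?thesis
    using assms by (simp add: DO_def depleted_def psd_scaleR psd_mat_1_minus_pure_state)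
qed

lemma completely_mixed_in_DO: "completely_mixed \<in> (DO :: (complex^'n::finite^'n) set)"
  using depleted_in_DO[of "axis undefined 1 :: complex^'n" 0]
  by (simp add: depleted_0 norm_axis_one)

lemma depleted_mult_self:
  fixes v :: "complex^'n::finite"
  assumes "norm v = 1"
  shows "depleted v s *v v = ((1 - s) / (real CARD('n) - s)) *\<^sub>R v"
proof -
  have "(mat 1 - s *\<^sub>R pure_state v) *v v = (1 - s) *\<^sub>R v"
    using assms by (simp add: matrix_vector_mult_diff_rdistrib scaleR_mult_vec pure_state_mult_self
        scaleR_left_diff_distrib)
  then show ?thesis
    by (simp add: depleted_def scaleR_mult_vec)
qed

lemma completely_mixed_mult_vec:
  "completely_mixed *v x = (1 / real CARD('n)) *\<^sub>R x" for x :: "complex^'n::finite"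
  by (simp add: completely_mixed_def scaleR_mult_vec)

text \<open>The weight \<open>s / n\<close> is the one that cancels the multiple of the pure state
  removed in \<open>depleted v s\<close>. For nonnegative \<open>s\<close> it puts the completely
  mixed state on the segment between the two, where convexity of the order can be applied.\<close>

lemma completely_mixed_convex_combination:
  fixes v :: "complex^'n::finite"
  assumes "s < real CARD('n)"
  shows "(1 - s / real CARD('n)) *\<^sub>R depleted v s + (s / real CARD('n)) *\<^sub>R pure_state v
    = completely_mixed"
proof -
  have "(1 - s / real CARD('n)) * (1 / (real CARD('n) - s)) = 1 / real CARD('n)"
    using assms by (simp add: field_simps)
  then have "(1 - s / real CARD('n)) *\<^sub>R depleted v s
      = (1 / real CARD('n)) *\<^sub>R (mat 1 - s *\<^sub>R pure_state v)"
    by (simp only: depleted_def scaleR_scaleR)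
  then show ?thesis
    by (simp add: completely_mixed_def scaleR_right_diff_distrib)
qed

lemma DO_eq_if_CARD_1:
  fixes A B :: "complex^'n::finite^'n"
  assumes "A \<in> DO" "B \<in> DO" "CARD('n) = 1"
  shows "A = B"
proof -
  obtain a :: 'n where a: "UNIV = {a}"
    using assms(3) card_1_singletonE by blast
  have "C $ i $ j = 1" if "C \<in> DO" for C :: "complex^'n^'n" and i j
  proof -
    have "i = a" "j = a"
      using a by blast+
    moreover have "trace C = C $ a $ a"
      unfolding trace_def a by simp
    ultimately show ?thesis
      using that by (simp add: DO_def)
  qed
  then show ?thesis
    using assms(1,2) by (simp add: vec_eq_iff)
qed

section \<open>The renormalised order and its values on pure states\<close>

lemma renormalised_orderD:
  assumes "(\<rho>, \<sigma>) \<in> renormalised_order f"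
  shows "x \<bullet> (\<sigma> *v x) / f \<sigma> \<le> x \<bullet> (\<rho> *v x) / f \<rho>"
  using assms psd_inner_nonneg[of "\<rho> /\<^sub>R f \<rho> - \<sigma> /\<^sub>R f \<sigma>" x]
  by (simp add: renormalised_order_def loewner_ge_def matrix_vector_mult_diff_rdistrib
      scaleR_mult_vec inner_diff_right divide_inverse mult.commute)

text \<open>By \<open>eq\<close> the two renormalised states have the same eigenvalue at
  \<open>v\<close>. Their difference thus vanishes on \<open>v\<close> and is a nonnegative multiple
  of the projection onto its orthogonal complement.\<close>

lemma depleted_below_pure_state:
  fixes v :: "complex^'n::finite"
  assumes v: "norm v = 1" and s: "s \<le> 1" "s < real CARD('n)"
    and f: "0 < f (depleted v s)"
    and eq: "(1 - s) / ((real CARD('n) - s) * f (depleted v s)) = 1 / f (pure_state v)"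
  shows "(depleted v s, pure_state v) \<in> renormalised_order f"
proof -
  \<comment> \<open>The eigenvalue of the renormalised \<open>depleted v s\<close> on the orthogonal
    complement of \<open>v\<close>.\<close>
  define a where "a = 1 / ((real CARD('n) - s) * f (depleted v s))"
  have fP: "inverse (f (pure_state v)) = a * (1 - s)"
    using eq by (simp add: a_def divide_inverse mult.commute)
  have fs: "depleted v s /\<^sub>R f (depleted v s) = a *\<^sub>R (mat 1 - s *\<^sub>R pure_state v)"
    by (simp add: depleted_def a_def divide_inverse mult.commute)
  have "depleted v s /\<^sub>R f (depleted v s) - pure_state v /\<^sub>R f (pure_state v)
      = a *\<^sub>R (mat 1 - 1 *\<^sub>R pure_state v)"
    unfolding fP fs by (simp add: algebra_simps)
  moreover have "0 \<le> a"
    using s f by (simp add: a_def)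
  ultimately show ?thesis
    using v s psd_mat_1_minus_pure_state[OF v, of 1]
    by (simp add: renormalised_order_def loewner_ge_def depleted_in_DO pure_state_in_DO psd_scaleR)
qed

lemma renormalisation_of_pure_state:
  fixes f :: "complex^'n::finite^'n \<Rightarrow> real" and v :: "complex^'n"
  assumes cont: "continuous_on DO f"
    and pos: "\<forall>\<rho>\<in>DO. 0 < f \<rho>"
    and antisym: "antisym (renormalised_order f)"
    and least: "\<forall>\<rho>\<in>DO. (completely_mixed, \<rho>) \<in> renormalised_order f"
    and interval: "\<And>\<rho> \<sigma> t. (\<rho>, \<sigma>) \<in> renormalised_order f \<Longrightarrow> t \<in> {0..1} \<Longrightarrow>
           (\<rho>, (1 - t) *\<^sub>R \<rho> + t *\<^sub>R \<sigma>) \<in> renormalised_order f"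
    and v: "norm v = 1"
  shows "f (pure_state v) = real CARD('n) * f completely_mixed"
proof (cases "CARD('n) = 1")
  case True
  then show ?thesis
    using DO_eq_if_CARD_1[OF pure_state_in_DO[OF v] completely_mixed_in_DO True] by simp
next
  case False
  then have n: "1 < CARD('n)"
    using zero_less_card_finite[where 'a = 'n] by linarith
  \<comment> \<open>The eigenvalue of the renormalised \<open>depleted v s\<close> at
    \<open>v\<close>; the target value \<open>1 / f (pure_state v)\<close> is the corresponding one
    for the pure state.\<close>
  define \<psi> where "\<psi> s = (1 - s) / ((real CARD('n) - s) * f (depleted v s))" for s
  have sn: "s < real CARD('n)" if "s \<le> 1" for s
    using that n by linarith
  have DO: "depleted v s \<in> DO" if "s \<le> 1" for s
    using depleted_in_DO[OF v that sn[OF that]] .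
  have fpos: "0 < f (depleted v s)" if "s \<le> 1" for s
    using DO[OF that] pos by blast
  have fP: "0 < f (pure_state v)" and f0: "0 < f completely_mixed"
    using pos v pure_state_in_DO completely_mixed_in_DO by blast+
  have vv: "v \<bullet> v = 1"
    using v by (simp add: norm_eq_1)
  \<comment> \<open>Minimality of the completely mixed state, tested at \<open>v\<close>, puts the
    target below \<open>\<psi> 0\<close>. At the other end \<open>\<psi> 1\<close> is zero.\<close>
  have "1 / f (pure_state v) \<le> 1 / real CARD('n) / f completely_mixed"
    using renormalised_orderD[of completely_mixed "pure_state v" f v] least
      pure_state_in_DO[OF v] v
    by (simp add: pure_state_mult_self completely_mixed_mult_vec vv)
  then have "1 / f (pure_state v) \<le> \<psi> 0"
    by (simp add: \<psi>_def depleted_0)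
  moreover have "\<psi> 1 \<le> 1 / f (pure_state v)"
    using fP by (simp add: \<psi>_def)
  moreover have "continuous_on {0..1} \<psi>"
  proof -
    have dep: "continuous_on {0..1} (depleted v)"
      unfolding depleted_def using sn by (intro continuous_intros) force
    have "continuous_on {0..1} (\<lambda>s. f (depleted v s))"
      by (rule continuous_on_compose2[OF cont dep]) (auto simp: DO)
    moreover have "(real CARD('n) - s) * f (depleted v s) \<noteq> 0" if "s \<in> {0..1}" for s
      using that sn[of s] fpos[of s] by simp
    ultimately show ?thesis
      unfolding \<psi>_def by (intro continuous_intros) auto
  qed
  ultimately obtain s where s: "0 \<le> s" "s \<le> 1" and eq: "\<psi> s = 1 / f (pure_state v)"
    using IVT2'[of \<psi> 1 "1 / f (pure_state v)" 0] by auto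
  have "(depleted v s, pure_state v) \<in> renormalised_order f"
    using depleted_below_pure_state[where f = f, OF v s(2) sn[OF s(2)] fpos[OF s(2)]] eq
    by (simp add: \<psi>_def)
  moreover have "s / real CARD('n) \<in> {0..1}"
    using s sn[of s] by simp
  ultimately have "(depleted v s, completely_mixed) \<in> renormalised_order f"
    using interval[of "depleted v s" "pure_state v" "s / real CARD('n)"]
      completely_mixed_convex_combination[OF sn[OF s(2)]] by simp
  then have mixed: "depleted v s = completely_mixed"
    using antisym least DO[OF s(2)] by (blast dest: antisymD)
  have "((1 - s) / (real CARD('n) - s)) = 1 / real CARD('n)"
    using arg_cong[OF mixed, of "\<lambda>A. v \<bullet> (A *v v)"]
    by (simp add: depleted_mult_self[OF v] completely_mixed_mult_vec vv)
  then have "\<psi> s = 1 / real CARD('n) / f completely_mixed"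
    by (simp add: \<psi>_def mixed flip: divide_divide_eq_left)
  then show ?thesis
    using eq fP f0 by (simp add: field_simps)
qed

text \<open>A constant factor in \<open>f\<close> only rescales the difference of the renormalised
  states, which preserves its positivity.\<close>

lemma renormalised_order_eq_qpe_order:
  assumes c: "0 < c" and f: "\<And>\<rho>. \<rho> \<in> DO \<Longrightarrow> f \<rho> = c * highest_eigenvalue \<rho>"
  shows "renormalised_order f = qpe_order"
proof -
  have "loewner_ge (\<rho> /\<^sub>R f \<rho>) (\<sigma> /\<^sub>R f \<sigma>) \<longleftrightarrow>
      loewner_ge (\<rho> /\<^sub>R highest_eigenvalue \<rho>) (\<sigma> /\<^sub>R highest_eigenvalue \<sigma>)"
    if "\<rho> \<in> DO" "\<sigma> \<in> DO" for \<rho> \<sigma>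
  proof -
    have "\<rho> /\<^sub>R f \<rho> - \<sigma> /\<^sub>R f \<sigma>
        = inverse c *\<^sub>R (\<rho> /\<^sub>R highest_eigenvalue \<rho> - \<sigma> /\<^sub>R highest_eigenvalue \<sigma>)"
      using that f by (simp add: scaleR_right_diff_distrib)
    then show ?thesis
      using c by (simp add: loewner_ge_def psd_scaleR_iff)
  qed
  then show ?thesis
    by (auto simp: renormalised_order_def qpe_order_def)
qed

theorem theorem13:
  fixes f :: "complex^'n::finite^'n \<Rightarrow> real"
  assumes "continuous_on DO f"
    and "\<forall>\<rho>\<in>DO. 0 < f \<rho>"
    and "partial_order_on DO (renormalised_order f)"
    and "\<forall>\<rho>\<in>DO. (completely_mixed, \<rho>) \<in> renormalised_order f"
    and "\<forall>\<rho>\<in>DO. \<forall>v. norm v = 1 \<and> eigenvector \<rho> v (highest_eigenvalue \<rho>) \<longrightarrow>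
           (\<rho>, pure_state v) \<in> renormalised_order f"
    and "\<forall>\<rho>\<in>DO. \<forall>\<sigma>\<in>DO. (\<rho>, \<sigma>) \<in> renormalised_order f \<longleftrightarrow>
           (\<forall>t\<in>{0..1}. (\<rho>, (1 - t) *\<^sub>R \<rho> + t *\<^sub>R \<sigma>) \<in> renormalised_order f \<and>
                        ((1 - t) *\<^sub>R \<rho> + t *\<^sub>R \<sigma>, \<sigma>) \<in> renormalised_order f)"
  shows "renormalised_order f = qpe_order"
proof -
  let ?c = "real CARD('n) * f completely_mixed"
  have f0: "0 < f completely_mixed"
    using assms(2) completely_mixed_in_DO by blast
  have antisym: "antisym (renormalised_order f)"
    using assms(3) by (simp add: partial_order_on_def)
  have pure: "f (pure_state v) = ?c" if "norm v = 1" for v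
  proof (rule renormalisation_of_pure_state[OF assms(1,2) antisym assms(4) _ that])
    fix \<rho> \<sigma> :: "complex^'n^'n" and t :: real
    assume "(\<rho>, \<sigma>) \<in> renormalised_order f" "t \<in> {0..1}"
    moreover from this have "\<rho> \<in> DO" "\<sigma> \<in> DO"
      by (auto simp: renormalised_order_def)
    ultimately show "(\<rho>, (1 - t) *\<^sub>R \<rho> + t *\<^sub>R \<sigma>) \<in> renormalised_order f"
      using assms(6) by blast
  qed
  show ?thesis
  proof (rule renormalised_order_eq_qpe_order)
    show "0 < ?c"
      using f0 by simp
    fix \<rho> :: "complex^'n^'n"
    assume \<rho>: "\<rho> \<in> DO"
    let ?l = "highest_eigenvalue \<rho>"
    have "hermitian \<rho>"
      using \<rho> by (simp add: DO_def psd_def)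
    then obtain v where v: "norm v = 1" and eig: "eigenvector \<rho> v ?l"
      by (rule highest_eigenvalue_attained)
    have vv: "v \<bullet> v = 1"
      using v by (simp add: norm_eq_1)
    have q: "v \<bullet> (\<rho> *v v) = ?l"
      using eig by (simp add: eigenvector_def of_real_vector_mult vv)
    have f\<rho>: "0 < f \<rho>"
      using assms(2) \<rho> by blast
    \<comment> \<open>The two bounds on \<open>f \<rho>\<close> come from the relations of
      \<open>\<rho>\<close> to the completely mixed state and to \<open>pure_state v\<close>, each
      tested at \<open>v\<close>. They meet because \<open>f\<close> has the same value
      \<open>?c\<close> on all pure states.\<close>
    have "?l / f \<rho> \<le> 1 / ?c"
      using renormalised_orderD[OF assms(4)[rule_format, OF \<rho>], of v]
      by (simp add: q completely_mixed_mult_vec vv)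
    moreover have "1 / ?c \<le> ?l / f \<rho>"
      using renormalised_orderD[of \<rho> "pure_state v" f v] assms(5) \<rho> v eig
      by (simp add: q pure_state_mult_self vv pure)
    ultimately have "?l / f \<rho> = 1 / ?c"
      by simp
    then show "f \<rho> = ?c * ?l"
      using f\<rho> f0 by (simp add: field_simps)
  qed
qed

end
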